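(* Let $E$ and $F$ be row-finite graphs such that $F$ is a reverse primitive transfer of $E$ at the vertex $v$. Then $\mathcal{G}_{(E,\{v\})}\cong\mathcal{G}_{(F,\{v\})}$ as topological groupoids.
   Context: Graphs. A directed graph $E$ consists of a vertex set $E^0$, an edge set $E^1$ and source and range maps $s,r:E^1\to E^0$. Throughout, "graph" means a countable directed graph without multiple edges (at most one edge from $v$ to $w$ for each ordered pair $(v,w)$; loops allowed) which is connected (any two vertices are joined by an undirected path). $E$ is row-finite if every vertex is the source of only finitely many edges. The vertex matrix $B_E$ is the $E^0\times E^0$ matrix with $B_E(v,w)=\#\{e\in E^1: s(e)=v,\ r(e)=w\}$. $E^*$ denotes the set of finite paths (including vertices as paths of length $0$), $E^\infty$ the set of infinite paths $x=x_1x_2\cdots$; $|\alpha|$ is the length of $\alpha\in E^*$. A vertex $v$ of $E$ is cofinal if for every $x\in E^\infty$ there is a finite path from $v$ to $s(x_i)$ for some $i$. Primitive transfer. Let $B$ be a (possibly infinite) square 0-1 matrix; write $B_p$ for its $p$-th row and $E_i$ for the row with a $1$ in position $i$ and $0$ elsewhere. Suppose $B_p$ is a nonzero row and $B_p=E_{k_1}+\cdots+E_{k_r}+B_{m_1}+\cdots+B_{m_s}$ for some distinct indices $k_1,\dots,k_r,m_1,\dots,m_s$ (all $r+s$ of them pairwise distinct) with $p\notin\{m_1,\dots,m_s\}$ and no $B_{m_i}$ a zero row. Let $C$ be the matrix which agrees with $B$ outside row $p$, and with $C_{pj}=1$ if $j\in\{k_1,\dots,k_r,m_1,\dots,m_s\}$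 and $C_{pj}=0$ otherwise. Then $C$ is a primitive transfer of $B$ at $p$. Reverse primitive transfer. $C$ is a reverse primitive transfer of $B$ at $v$ if $C^T$ is a primitive transfer of $B^T$ at $v$ and $v$ is a cofinal vertex (of the graph with vertex matrix $B$). A graph $F$ is a reverse primitive transfer of $E$ at $v$ if this holds for their vertex matrices (so $E^0$ and $F^0$ are identified). Path groupoid. For $x,y\in E^\infty$, $k\in\mathbf{Z}$, write $x\sim_k y$ if $x_i=y_{i-k}$ for all large $i$. Then $\mathcal{G}_E=\{(x,k,y):x\sim_k y\}$ with $(x,k,y)^{-1}=(y,-k,x)$ and $(x,k,y)(y,l,z)=(x,k+l,z)$, with the topology generated by the sets $Z(\alpha,\beta)=\{(\alpha x,|\alpha|-|\beta|,\beta x): x\in E^\infty,\ s(x)=r(\alpha)\}$ for $\alpha,\beta\in E^*$ with $r(\alpha)=r(\beta)$. For $S\subseteq E^0$, $\mathcal{G}_{(E,S)}$ is the restriction of $\mathcal{G}_E$ to the clopen set of units $\{x\in E^\infty: s(x)\in S\}$, i.e. $\{(x,k,y)\in\mathcal{G}_E: s(x),s(y)\in S\}$. *)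

theory Defs
  imports
    "HOL-Analysis.Analysis"
    "HOL-Library.Omega_Words_Fun"
    "Graph_Theory.Digraph_Component"
    "Graph_Theory.Arc_Walk"
begin

section \<open>Graphs and their path spaces\<close>

text \<open>
  The source and range maps are \<^const>\<open>tail\<close> and \<^const>\<open>head\<close>. Loops are allowed, and
  the graph may be infinite. The qualified name avoids topological connectedness;
  \<^const>\<open>Digraph_Component.connected\<close> disregards the direction of the arcs.
\<close>

locale path_graph = nomulti_digraph G for G :: "('a, 'e) pre_digraph" (structure) +
  assumes countable_verts: "countable (verts G)"
    and connected: "Digraph_Component.connected G"

definition row_finite :: "('a, 'e) pre_digraph \<Rightarrow> bool" where
  "row_finite G \<longleftrightarrow> (\<forall>v \<in> verts G. finite (out_arcs G v))"

definition vertex_matrix :: "('a, 'e) pre_digraph \<Rightarrow> 'a \<Rightarrow> 'a \<Rightarrow> nat" where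
  "vertex_matrix G v w = card {e \<in> arcs G. tail G e = v \<and> head G e = w}"

text \<open>
  Infinite paths are indexed from 0. A finite path from \<open>u\<close> to \<open>w\<close> is an arc list \<open>\<alpha>\<close> with
  \<open>pre_digraph.awalk G u \<alpha> w\<close>; the end points are carried separately because
  a path of length 0 does not determine its vertex.
\<close>

definition inf_paths :: "('a, 'e) pre_digraph \<Rightarrow> 'e word set" where
  "inf_paths G = {x. \<forall>i. x i \<in> arcs G \<and> head G (x i) = tail G (x (Suc i))}"

definition inf_source :: "('a, 'e) pre_digraph \<Rightarrow> 'e word \<Rightarrow> 'a" where
  "inf_source G x = tail G (x 0)"

definition cofinal_vertex :: "('a, 'e) pre_digraph \<Rightarrow> 'a \<Rightarrow> bool" where
  "cofinal_vertex G v \<longleftrightarrow>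
     v \<in> verts G \<and> (\<forall>x \<in> inf_paths G. \<exists>i \<alpha>. pre_digraph.awalk G v \<alpha> (tail G (x i)))"

section \<open>Primitive transfers\<close>

text \<open>
  Square matrices indexed by \<open>I\<close>; values outside \<open>I \<times> I\<close> are irrelevant. The sets \<open>K\<close> and \<open>M\<close>
  consist of the pairwise distinct indices \<open>k\<^sub>1, \<dots>, k\<^sub>r\<close> and \<open>m\<^sub>1, \<dots>, m\<^sub>s\<close>. Either may be
  empty, and \<open>p \<in> K\<close> is allowed.
\<close>

definition zero_row :: "'a set \<Rightarrow> ('a \<Rightarrow> 'a \<Rightarrow> nat) \<Rightarrow> 'a \<Rightarrow> bool" where
  "zero_row I B i \<longleftrightarrow> (\<forall>j \<in> I. B i j = 0)"

definition primitive_transfer ::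
  "'a set \<Rightarrow> ('a \<Rightarrow> 'a \<Rightarrow> nat) \<Rightarrow> ('a \<Rightarrow> 'a \<Rightarrow> nat) \<Rightarrow> 'a \<Rightarrow> bool" where
  "primitive_transfer I B C p \<longleftrightarrow>
     (\<forall>i \<in> I. \<forall>j \<in> I. B i j \<in> {0, 1}) \<and>
     p \<in> I \<and> \<not> zero_row I B p \<and>
     (\<exists>K M. finite K \<and> finite M \<and> K \<subseteq> I \<and> M \<subseteq> I \<and> K \<inter> M = {} \<and> p \<notin> M \<and>
        (\<forall>m \<in> M. \<not> zero_row I B m) \<and>
        (\<forall>j \<in> I. B p j = (\<Sum>k \<in> K. if j = k then 1 else 0) + (\<Sum>m \<in> M. B m j)) \<and>
        (\<forall>i \<in> I. i \<noteq> p \<longrightarrow> (\<forall>j \<in> I. C i j = B i j)) \<and>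
        (\<forall>j \<in> I. C p j = (if j \<in> K \<union> M then 1 else 0)))"

definition matrix_transpose :: "('a \<Rightarrow> 'a \<Rightarrow> nat) \<Rightarrow> 'a \<Rightarrow> 'a \<Rightarrow> nat" where
  "matrix_transpose B = (\<lambda>i j. B j i)"

text \<open>\<open>F\<close> is a reverse primitive transfer of \<open>E\<close> at \<open>v\<close>; the two vertex sets are identified.\<close>

definition reverse_primitive_transfer ::
  "('a, 'e) pre_digraph \<Rightarrow> ('a, 'f) pre_digraph \<Rightarrow> 'a \<Rightarrow> bool" where
  "reverse_primitive_transfer E F v \<longleftrightarrow>
     verts F = verts E \<and>
     primitive_transfer (verts E)
       (matrix_transpose (vertex_matrix E)) (matrix_transpose (vertex_matrix F)) v \<and>
     cofinal_vertex E v"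

section \<open>Groupoids carrying a topology\<close>

text \<open>The values of \<open>gmult\<close> matter only on the pairs in \<open>gcomposable\<close>.\<close>

record 'g top_groupoid =
  garrows :: "'g set"
  gcomposable :: "('g \<times> 'g) set"
  gmult :: "'g \<Rightarrow> 'g \<Rightarrow> 'g"
  ginv :: "'g \<Rightarrow> 'g"
  gtopology :: "'g topology"

definition top_groupoid_iso :: "'g top_groupoid \<Rightarrow> 'h top_groupoid \<Rightarrow> ('g \<Rightarrow> 'h) \<Rightarrow> bool" where
  "top_groupoid_iso \<G> \<H> \<phi> \<longleftrightarrow>
     bij_betw \<phi> (garrows \<G>) (garrows \<H>) \<and>
     homeomorphic_map (gtopology \<G>) (gtopology \<H>) \<phi> \<and>
     (\<forall>a \<in> garrows \<G>. \<forall>b \<in> garrows \<G>.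
        (\<phi> a, \<phi> b) \<in> gcomposable \<H> \<longleftrightarrow> (a, b) \<in> gcomposable \<G>) \<and>
     (\<forall>(a, b) \<in> gcomposable \<G>. \<phi> (gmult \<G> a b) = gmult \<H> (\<phi> a) (\<phi> b)) \<and>
     (\<forall>a \<in> garrows \<G>. \<phi> (ginv \<G> a) = ginv \<H> (\<phi> a))"

definition top_groupoid_isomorphic :: "'g top_groupoid \<Rightarrow> 'h top_groupoid \<Rightarrow> bool" where
  "top_groupoid_isomorphic \<G> \<H> \<longleftrightarrow> (\<exists>\<phi>. top_groupoid_iso \<G> \<H> \<phi>)"

section \<open>The path groupoid\<close>

type_synonym 'e path_arrow = "'e word \<times> int \<times> 'e word"

text \<open>
  Only large \<open>i\<close> matter, so the truncation of \<open>i - k\<close> at 0 by \<^const>\<open>nat\<close> is harmless.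
\<close>

definition tail_equiv :: "int \<Rightarrow> 'e word \<Rightarrow> 'e word \<Rightarrow> bool" where
  "tail_equiv k x y \<longleftrightarrow> (\<forall>\<^sub>F i in sequentially. x i = y (nat (int i - k)))"

definition path_arrows :: "('a, 'e) pre_digraph \<Rightarrow> 'e path_arrow set" where
  "path_arrows G = {(x, k, y). x \<in> inf_paths G \<and> y \<in> inf_paths G \<and> tail_equiv k x y}"

text \<open>\<open>Z(\<alpha>, \<beta>)\<close> for finite paths with common range \<open>w\<close>.\<close>

definition path_cylinder ::
  "('a, 'e) pre_digraph \<Rightarrow> 'e list \<Rightarrow> 'e list \<Rightarrow> 'a \<Rightarrow> 'e path_arrow set" where
  "path_cylinder G \<alpha> \<beta> w =
     {(\<alpha> \<frown> x, int (length \<alpha>) - int (length \<beta>), \<beta> \<frown> x) | x.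
        x \<in> inf_paths G \<and> inf_source G x = w}"

definition path_topology :: "('a, 'e) pre_digraph \<Rightarrow> 'e path_arrow topology" where
  "path_topology G = topology_generated_by
     {path_cylinder G \<alpha> \<beta> w | \<alpha> \<beta> w u u'. pre_digraph.awalk G u \<alpha> w \<and> pre_digraph.awalk G u' \<beta> w}"

definition path_groupoid :: "('a, 'e) pre_digraph \<Rightarrow> 'e path_arrow top_groupoid" where
  "path_groupoid G =
     \<lparr> garrows = path_arrows G,
       gcomposable = {((x, k, y), (y', l, z)).
          (x, k, y) \<in> path_arrows G \<and> (y', l, z) \<in> path_arrows G \<and> y = y'},
       gmult = (\<lambda>(x, k, y) (y', l, z). (x, k + l, z)),
       ginv = (\<lambda>(x, k, y). (y, - k, x)),
       gtopology = path_topology G \<rparr>"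

definition restricted_path_groupoid ::
  "('a, 'e) pre_digraph \<Rightarrow> 'a set \<Rightarrow> 'e path_arrow top_groupoid" where
  "restricted_path_groupoid G S =
     (let A = {(x, k, y) \<in> path_arrows G. inf_source G x \<in> S \<and> inf_source G y \<in> S} in
      (path_groupoid G)
        \<lparr> garrows := A,
          gcomposable := gcomposable (path_groupoid G) \<inter> (A \<times> A),
          gtopology := subtopology (path_topology G) A \<rparr>)"

end

(* An arc j -> v of E with j not in K comes from exactly one m in M with an arc j -> m, and in F
   it is replaced by the detour j -> m -> v; all other arcs of E are arcs of F. Performing this
   substitution along infinite paths is a bijection from the paths of E from v to those of F from v:
   the inverse contracts j -> m -> v to j -> v at every arc m -> v with m in M, and such an arc is
   never the first one because v is not in M. The substitution acts letter by letter, so it respects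
   tail equivalence and cylinders, the lag k = |alpha| - |beta| becoming the difference of the
   lengths of the substituted words. *)

theory Submission
  imports Defs
begin

text \<open>Counting makes the detour well defined: in the column of v the sums over K and M add up
  to an entry that is 0 or 1, so exactly one summand accounts for an arc j -> v of E. The half j ->
  m of the detour exists in F because m is not v and only column v changes. Two arcs m -> v with m
  in M never follow one another, since they end at v and start in M. The obstacle is that paths of F
  starting with such an arc have no preimage. Restricting to paths from v removes them, but they
  come back locally: a cylinder of E may end at a vertex of M, and openness of its image is obtained
  by fixing one more arc. The new lag is not a function of k alone; it depends on the arcs before
  the common tail. It is therefore defined through a choice of cut positions, and has to be shown
  independent of that choice, additive, and injective in k for given end paths.\<close>

lemma inf_paths_suffix: "x \<in> inf_paths G \<Longrightarrow> suffix n x \<in> inf_paths G"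
  by (simp add: inf_paths_def)

lemma inf_paths_conc_tail:
  assumes "p \<frown> x \<in> inf_paths G"
  shows "x \<in> inf_paths G"
  using inf_paths_suffix[OF assms, of "length p"] by simp

lemma inf_paths_arcs: "x \<in> inf_paths G \<Longrightarrow> x n \<in> arcs G"
  by (simp add: inf_paths_def)

context wf_digraph
begin

lemma inf_paths_prefix_awalk:
  assumes "x \<in> inf_paths G"
  shows "awalk (tail G (x 0)) (prefix n x) (tail G (x n))"
proof (induction n)
  case 0
  then show ?case using assms by (simp add: awalk_Nil_iff inf_paths_def)
next
  case (Suc n)
  have "awalk (tail G (x n)) [x n] (tail G (x (Suc n)))"
    using assms arc_implies_awalk[of "x n"] by (simp add: inf_paths_def)
  with Suc show ?case by (auto intro: awalk_appendI)
qed

lemma inf_paths_build: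
  assumes "e \<in> arcs G" "x \<in> inf_paths G" "inf_source G x = head G e"
  shows "e ## x \<in> inf_paths G"
  unfolding inf_paths_def
proof (clarify)
  fix i
  show "(e ## x) i \<in> arcs G \<and> head G ((e ## x) i) = tail G ((e ## x) (Suc i))"
    using assms by (cases i) (auto simp: inf_paths_def inf_source_def)
qed

lemma inf_paths_conc:
  assumes "awalk u p w" "x \<in> inf_paths G" "inf_source G x = w"
  shows "p \<frown> x \<in> inf_paths G" "inf_source G (p \<frown> x) = u"
proof -
  have "p \<frown> x \<in> inf_paths G \<and> inf_source G (p \<frown> x) = u"
    using assms
  proof (induction p arbitrary: u)
    case Nil
    then show ?case by (simp add: awalk_Nil_iff)
  next
    case (Cons e p)
    then have "e \<in> arcs G" "u = tail G e" "awalk (head G e) p w"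
      by (auto simp: awalk_Cons_iff)
    with Cons show ?case
      by (auto intro!: inf_paths_build simp: inf_source_def)
  qed
  then show "p \<frown> x \<in> inf_paths G" "inf_source G (p \<frown> x) = u" by auto
qed

end

section \<open>Tail equivalence as equality of shifted paths\<close>

lemma tail_equiv_iff_suffix:
  "tail_equiv k x y \<longleftrightarrow> (\<exists>m n. k = int m - int n \<and> suffix m x = suffix n y)"
proof
  assume "tail_equiv k x y"
  then obtain N where N: "\<And>i. i \<ge> N \<Longrightarrow> x i = y (nat (int i - k))"
    by (auto simp: tail_equiv_def eventually_sequentially)
  \<comment> \<open>This \<open>m\<close> is at least \<open>N\<close> and at least
    \<open>k\<close>, so \<open>nat\<close> does not truncate \<open>int m - k\<close>.\<close>
  define m where "m = N + nat k"
  define n where "n = nat (int m - k)"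
  have "k = int m - int n" by (simp add: m_def n_def)
  moreover have "suffix m x i = suffix n y i" for i
  proof -
    have "nat (int (m + i) - k) = n + i" unfolding m_def n_def by linarith
    then show ?thesis using N[of "m + i"] by (simp add: m_def)
  qed
  ultimately show "\<exists>m n. k = int m - int n \<and> suffix m x = suffix n y" by blast
next
  assume "\<exists>m n. k = int m - int n \<and> suffix m x = suffix n y"
  then obtain m n where k: "k = int m - int n" and eq: "suffix m x = suffix n y" by blast
  have "x i = y (nat (int i - k))" if "i \<ge> m" for i
  proof -
    have "nat (int i - k) = n + (i - m)" using k that by simp
    moreover have "x i = suffix m x (i - m)" using that by simp
    ultimately show ?thesis using eq by simp
  qed
  then show "tail_equiv k x y"
    by (auto simp: tail_equiv_def eventually_sequentially)
qed

lemma suffix_eq_shift: "suffix m x = suffix n y \<Longrightarrow> suffix (m + p) x = suffix (n + p) y"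
  by (metis suffix_suffix)

lemma tail_equivI: "suffix m x = suffix n y \<Longrightarrow> tail_equiv (int m - int n) x y"
  by (auto simp: tail_equiv_iff_suffix)

section \<open>Arrows and topology of the restricted groupoid\<close>

definition path_arrows_over :: "('a, 'e) pre_digraph \<Rightarrow> 'a set \<Rightarrow> 'e path_arrow set" where
  "path_arrows_over G S =
     {(x, k, y) \<in> path_arrows G. inf_source G x \<in> S \<and> inf_source G y \<in> S}"

lemma path_arrows_over_iff:
  "(x, k, y) \<in> path_arrows_over G S \<longleftrightarrow>
     x \<in> inf_paths G \<and> y \<in> inf_paths G \<and> tail_equiv k x y \<and>
     inf_source G x \<in> S \<and> inf_source G y \<in> S"
  by (auto simp: path_arrows_over_def path_arrows_def)

lemma restricted_path_groupoid_simps: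
  "garrows (restricted_path_groupoid G S) = path_arrows_over G S"
  "gcomposable (restricted_path_groupoid G S) =
     {((x, k, y), (y', l, z)). (x, k, y) \<in> path_arrows_over G S \<and>
        (y', l, z) \<in> path_arrows_over G S \<and> y = y'}"
  "gmult (restricted_path_groupoid G S) = (\<lambda>(x, k, y) (y', l, z). (x, k + l, z))"
  "ginv (restricted_path_groupoid G S) = (\<lambda>(x, k, y). (y, - k, x))"
  "gtopology (restricted_path_groupoid G S) = subtopology (path_topology G) (path_arrows_over G S)"
  by (auto simp: restricted_path_groupoid_def path_groupoid_def path_arrows_over_def Let_def)

definition path_cylinders :: "('a, 'e) pre_digraph \<Rightarrow> 'e path_arrow set set" where
  "path_cylinders G = {path_cylinder G \<alpha> \<beta> w | \<alpha> \<beta> w u u'.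
     pre_digraph.awalk G u \<alpha> w \<and> pre_digraph.awalk G u' \<beta> w}"

lemma path_topology_generated: "path_topology G = topology_generated_by (path_cylinders G)"
  by (simp add: path_topology_def path_cylinders_def)

context wf_digraph
begin

text \<open>Any cut \<open>m\<close>, \<open>n\<close> at which the tails agree gives a cylinder
  around the arrow; late cuts provide small neighbourhoods.\<close>

lemma prefix_cylinder:
  assumes "x \<in> inf_paths G" "y \<in> inf_paths G" "suffix m x = suffix n y"
  defines "Z \<equiv> path_cylinder G (prefix m x) (prefix n y) (tail G (x m))"
  shows "Z \<in> path_cylinders G" "(x, int m - int n, y) \<in> Z"
proof -
  have "suffix m x 0 = suffix n y 0" using assms(3) by simp
  then have "tail G (x m) = tail G (y n)" by simp
  then show "Z \<in> path_cylinders G"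
    unfolding Z_def path_cylinders_def
    using inf_paths_prefix_awalk[OF assms(1), of m] inf_paths_prefix_awalk[OF assms(2), of n] by auto
  have "y = prefix n y \<frown> suffix m x"
    by (simp only: assms(3) prefix_suffix[symmetric])
  then show "(x, int m - int n, y) \<in> Z"
    unfolding Z_def path_cylinder_def
    using inf_paths_suffix[OF assms(1), of m]
    by (auto simp: inf_source_def intro!: exI[of _ "suffix m x"])
qed

lemma topspace_path_subtopology:
  "topspace (subtopology (path_topology G) (path_arrows_over G S)) = path_arrows_over G S"
proof -
  have "a \<in> \<Union> (path_cylinders G)" if "a \<in> path_arrows_over G S" for a
  proof -
    obtain x k y where a: "a = (x, k, y)" by (cases a) auto
    with that obtain m n where "k = int m - int n" "suffix m x = suffix n y"
      "x \<in> inf_paths G" "y \<in> inf_paths G"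
      by (auto simp: path_arrows_over_iff tail_equiv_iff_suffix)
    then show ?thesis using prefix_cylinder a by blast
  qed
  then show ?thesis
    by (auto simp: path_topology_generated topology_generated_by_topspace)
qed

end

text \<open>The generators are used one at a time: \<open>V\<close> is the trace of a union of
  cylinders, so no finite intersections have to be formed.\<close>

lemma openin_path_subtopology:
  assumes "V \<subseteq> A"
    and "\<And>a. a \<in> V \<Longrightarrow> \<exists>U \<in> path_cylinders G. a \<in> U \<and> U \<inter> A \<subseteq> V"
  shows "openin (subtopology (path_topology G) A) V"
  unfolding openin_subtopology
proof (intro exI conjI)
  let ?W = "\<Union> {U \<in> path_cylinders G. U \<inter> A \<subseteq> V}"
  show "openin (path_topology G) ?W"
    by (auto simp: path_topology_generated intro: topology_generated_by_Basis)
  show "V = ?W \<inter> A" using assms by blast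
qed

text \<open>Preimages of generators suffice in the target, and in the source one cylinder around
  each point; this is the form in which both directions of the homeomorphism are checked.\<close>

lemma continuous_map_path_subtopology:
  assumes "wf_digraph G" "wf_digraph H"
    and f: "\<And>a. a \<in> path_arrows_over G S \<Longrightarrow> f a \<in> path_arrows_over H T"
    and nbhd: "\<And>a Z. \<lbrakk>a \<in> path_arrows_over G S; Z \<in> path_cylinders H; f a \<in> Z\<rbrakk> \<Longrightarrow>
      \<exists>U \<in> path_cylinders G. a \<in> U \<and> f ` (U \<inter> path_arrows_over G S) \<subseteq> Z"
  shows "continuous_map (subtopology (path_topology G) (path_arrows_over G S))
           (subtopology (path_topology H) (path_arrows_over H T)) f"
    (is "continuous_map ?X ?Y f")
proof -
  have X: "topspace ?X = path_arrows_over G S"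
    by (rule wf_digraph.topspace_path_subtopology[OF assms(1)])
  have Y: "path_arrows_over H T \<subseteq> \<Union> (path_cylinders H)"
    using wf_digraph.topspace_path_subtopology[OF assms(2), of T]
    by (auto simp: path_topology_generated topology_generated_by_topspace)
  have "continuous_map ?X (path_topology H) f"
    unfolding path_topology_generated[of H]
  proof (rule continuous_on_generated_topo)
    fix Z assume Z: "Z \<in> path_cylinders H"
    show "openin ?X (f -` Z \<inter> topspace ?X)"
    proof (rule openin_path_subtopology)
      fix a assume "a \<in> f -` Z \<inter> topspace ?X"
      then have "a \<in> path_arrows_over G S" "f a \<in> Z" using X by blast+
      then obtain U where "U \<in> path_cylinders G" "a \<in> U" "f ` (U \<inter> path_arrows_over G S) \<subseteq> Z"
        using nbhd Z by blast
      then show "\<exists>U \<in> path_cylinders G. a \<in> U \<and>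
          U \<inter> path_arrows_over G S \<subseteq> f -` Z \<inter> topspace ?X"
        using X by blast
    qed (use X in blast)
  qed (use X Y f in blast)
  then show ?thesis
    using X f by (auto simp: continuous_map_in_subtopology)
qed

text \<open>Arcs in \<open>D\<close> continue an image word, arcs outside \<open>D\<close> begin one: this is how a path of \<open>F\<close>
  is cut into image words.\<close>

locale arc_substitution = E: wf_digraph E + F: wf_digraph F
  for E :: "('a, 'e) pre_digraph" and F :: "('a, 'f) pre_digraph" +
  fixes \<theta> :: "'e \<Rightarrow> 'f list" and D :: "'f set"
  assumes image_awalk: "e \<in> arcs E \<Longrightarrow> F.awalk (tail E e) (\<theta> e) (head E e)"
    and image_nonempty: "e \<in> arcs E \<Longrightarrow> \<theta> e \<noteq> []"
    and image_hd: "e \<in> arcs E \<Longrightarrow> hd (\<theta> e) \<notin> D"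
    and image_tl: "e \<in> arcs E \<Longrightarrow> set (tl (\<theta> e)) \<subseteq> D"
    and inj_image: "inj_on \<theta> (arcs E)"
    and decode: "\<lbrakk>y \<in> inf_paths F; y 0 \<notin> D\<rbrakk> \<Longrightarrow> \<exists>e \<in> arcs E. \<exists>z. z 0 \<notin> D \<and> y = \<theta> e \<frown> z"
begin

section \<open>Substitution in finite and infinite words\<close>

definition subst_list :: "'e list \<Rightarrow> 'f list" where
  "subst_list \<alpha> = concat (map \<theta> \<alpha>)"

text \<open>On paths every image word is nonempty, so the images of the arcs 0 to \<open>n\<close>
  have at least \<open>n + 1\<close> letters and the index \<open>n\<close> is in range.\<close>

definition subst_word :: "'e word \<Rightarrow> 'f word" where
  "subst_word x = (\<lambda>n. subst_list (prefix (Suc n) x) ! n)"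

text \<open>For a path \<open>x\<close> this is the place in \<open>subst_word x\<close> at which
  the image word of the arc \<open>x m\<close> begins.\<close>

definition pos :: "'e word \<Rightarrow> nat \<Rightarrow> nat" where
  "pos x m = length (subst_list (prefix m x))"

lemma subst_list_simps [simp]:
  "subst_list [] = []"
  "subst_list (e # \<alpha>) = \<theta> e @ subst_list \<alpha>"
  "subst_list (\<alpha> @ \<beta>) = subst_list \<alpha> @ subst_list \<beta>"
  by (simp_all add: subst_list_def)

lemma length_subst_list: "set \<alpha> \<subseteq> arcs E \<Longrightarrow> length \<alpha> \<le> length (subst_list \<alpha>)"
proof (induction \<alpha>)
  case (Cons e \<alpha>)
  then have "length (\<theta> e) > 0" using image_nonempty by auto
  moreover have "length \<alpha> \<le> length (subst_list \<alpha>)" using Cons by auto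
  ultimately show ?case by (simp; linarith)
qed simp

text \<open>The condition on \<open>w\<close> serves the empty walk, as the vertex sets are not
  identified in this locale.\<close>

lemma awalk_subst_list: "E.awalk u \<alpha> w \<Longrightarrow> w \<in> verts F \<Longrightarrow> F.awalk u (subst_list \<alpha>) w"
proof (induction \<alpha> arbitrary: u)
  case Nil
  then show ?case by (simp add: E.awalk_Nil_iff F.awalk_Nil_iff)
next
  case (Cons e \<alpha>)
  then show ?case
    using image_awalk[of e] by (auto simp: E.awalk_Cons_iff intro: F.awalk_appendI)
qed

lemma pos_0 [simp]: "pos x 0 = 0"
  by (simp add: pos_def)

lemma pos_add: "pos x (m + n) = pos x m + pos (suffix m x) n"
  by (simp add: pos_def subsequence_append)

lemma pos_ge:
  assumes "x \<in> inf_paths E"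
  shows "n \<le> pos x n"
  using length_subst_list[of "prefix n x"] inf_paths_arcs[OF assms] by (auto simp: pos_def)

lemma pos_strict_mono:
  assumes "x \<in> inf_paths E"
  shows "strict_mono (pos x)"
proof (rule strict_monoI)
  fix m n :: nat
  assume "m < n"
  then show "pos x m < pos x n"
    using pos_add[of x m "n - m"] pos_ge[OF inf_paths_suffix[OF assms], of "n - m" m] by simp
qed

text \<open>The letter at \<open>n\<close> is read from the image of the prefix of length
  \<open>Suc n\<close>; any other prefix whose image reaches beyond \<open>n\<close> shows the same
  letter, because one of the two images is an initial segment of the other.\<close>

lemma prefix_subst_word:
  assumes x: "x \<in> inf_paths E"
  shows "prefix (pos x m) (subst_word x) = subst_list (prefix m x)"
proof (rule nth_equalityI)
  fix n
  assume "n < length (prefix (pos x m) (subst_word x))"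
  then have n: "n < pos x m" by simp
  have n': "n < pos x (Suc n)" using pos_ge[OF x, of "Suc n"] by simp
  have split: "prefix (i + j) x = prefix i x @ prefix j (suffix i x)" for i j
    by (simp add: subsequence_append)
  have "subst_list (prefix (Suc n) x) ! n = subst_list (prefix m x) ! n"
  proof (cases "Suc n \<le> m")
    case True
    with split[of "Suc n" "m - Suc n"] n' show ?thesis
      by (simp add: nth_append pos_def del: subseq_to_Suc)
  next
    case False
    with split[of m "Suc n - m"] n show ?thesis
      by (simp add: nth_append pos_def del: subseq_to_Suc)
  qed
  with n show "prefix (pos x m) (subst_word x) ! n = subst_list (prefix m x) ! n"
    by (simp add: subst_word_def del: subseq_to_Suc)
qed (simp add: pos_def)

text \<open>Shifts are intertwined with a change of time by \<open>pos\<close>; this carries common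
  tails from E to F.\<close>

lemma suffix_subst_word:
  assumes x: "x \<in> inf_paths E"
  shows "suffix (pos x m) (subst_word x) = subst_word (suffix m x)"
proof
  fix n
  have n: "n < pos (suffix m x) (Suc n)"
    using pos_ge[OF inf_paths_suffix[OF x], of "Suc n" m] by simp
  then have "subst_word x (pos x m + n) = prefix (pos x (m + Suc n)) (subst_word x) ! (pos x m + n)"
    by (simp only: pos_add) simp
  also have "\<dots> = subst_list (prefix (m + Suc n) x) ! (pos x m + n)"
    by (simp only: prefix_subst_word[OF x])
  also have "prefix (m + Suc n) x = prefix m x @ prefix (Suc n) (suffix m x)"
    by (simp add: subsequence_append del: add_Suc_right subseq_to_Suc)
  also have "subst_list \<dots> ! (pos x m + n) = subst_word (suffix m x) n"
    by (simp add: pos_def nth_append subst_word_def del: subseq_to_Suc subsequence_shift)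
  finally show "suffix (pos x m) (subst_word x) n = subst_word (suffix m x) n" by simp
qed

lemma subst_word_split:
  assumes "x \<in> inf_paths E"
  shows "subst_word x = subst_list (prefix m x) \<frown> subst_word (suffix m x)"
  using prefix_suffix[of "subst_word x" "pos x m"]
  by (simp add: prefix_subst_word[OF assms] suffix_subst_word[OF assms] del: prefix_suffix[symmetric])

lemma subst_word_conc:
  assumes "\<alpha> \<frown> x \<in> inf_paths E"
  shows "subst_word (\<alpha> \<frown> x) = subst_list \<alpha> \<frown> subst_word x"
  using subst_word_split[OF assms, of "length \<alpha>"] by simp

lemma subst_word_step:
  assumes "x \<in> inf_paths E"
  shows "subst_word x = \<theta> (x 0) \<frown> subst_word (suffix (Suc 0) x)"
  using subst_word_split[OF assms, of "Suc 0"] by simp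

lemma subst_word_0:
  assumes "x \<in> inf_paths E"
  shows "subst_word x 0 = hd (\<theta> (x 0))"
  using subst_word_step[OF assms] image_nonempty[OF inf_paths_arcs[OF assms], of 0]
  by (simp add: hd_conv_nth)

lemma subst_word_0_notin:
  assumes "x \<in> inf_paths E"
  shows "subst_word x 0 \<notin> D"
  using subst_word_0[OF assms] image_hd[OF inf_paths_arcs[OF assms]] by simp

lemma inf_source_subst_word:
  assumes "x \<in> inf_paths E"
  shows "inf_source F (subst_word x) = inf_source E x"
proof -
  have e: "x 0 \<in> arcs E" using inf_paths_arcs[OF assms] .
  then show ?thesis
    using image_awalk[OF e] image_nonempty[OF e]
    by (cases "\<theta> (x 0)") (auto simp: inf_source_def subst_word_0[OF assms] F.awalk_Cons_iff)
qed

text \<open>Two neighbouring letters may belong to different image words, so both are read off one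
  finite walk: the image of the first \<open>i + 2\<close> arcs, which has at least
  \<open>i + 2\<close> letters.\<close>

lemma subst_word_inf_paths:
  assumes x: "x \<in> inf_paths E"
  shows "subst_word x \<in> inf_paths F"
  unfolding inf_paths_def
proof (clarify)
  fix i
  let ?p = "subst_list (prefix (Suc (Suc i)) x)"
  have "E.awalk (tail E (x 0)) (prefix (Suc (Suc i)) x) (tail E (x (Suc (Suc i))))"
    by (rule E.inf_paths_prefix_awalk[OF x])
  moreover have "tail E (x (Suc (Suc i))) \<in> verts F"
    using image_awalk[OF inf_paths_arcs[OF x]] by (rule F.awalk_hd_in_verts)
  ultimately have w: "F.awalk (tail E (x 0)) ?p (tail E (x (Suc (Suc i))))"
    by (rule awalk_subst_list)
  have len: "Suc (Suc i) \<le> pos x (Suc (Suc i))" by (rule pos_ge[OF x])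
  have eq: "?p = prefix (pos x (Suc (Suc i))) (subst_word x)"
    by (rule prefix_subst_word[OF x, symmetric])
  have nth: "?p ! i = subst_word x i" "?p ! Suc i = subst_word x (Suc i)"
    using len by (simp_all only: eq) simp_all
  have len': "Suc i < length ?p" using len by (simp add: pos_def)
  have "?p = take i ?p @ ?p ! i # ?p ! Suc i # drop (Suc (Suc i)) ?p"
    using len' by (simp only: Cons_nth_drop_Suc Suc_lessD append_take_drop_id)
  then have "F.awalk (tail E (x 0)) (take i ?p @ ?p ! i # ?p ! Suc i # drop (Suc (Suc i)) ?p)
      (tail E (x (Suc (Suc i))))" using w by simp
  then show "subst_word x i \<in> arcs F \<and> head F (subst_word x i) = tail F (subst_word x (Suc i))"
    unfolding nth by (auto simp: F.awalk_Cons_iff F.awalk_append_iff)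
qed

section \<open>Unique readability and decoding\<close>

text \<open>If one word were shorter, the letter after it, which is outside \<open>D\<close>, would
  be a non-initial letter of the longer one and hence in \<open>D\<close>.\<close>

lemma image_parse:
  assumes "p \<frown> u = q \<frown> u'" "p \<noteq> []" "q \<noteq> []" "set (tl p) \<subseteq> D" "set (tl q) \<subseteq> D"
    "u 0 \<notin> D" "u' 0 \<notin> D"
  shows "p = q"
proof -
  have *: "\<not> length p < length q"
    if "p \<frown> u = q \<frown> u'" "p \<noteq> []" "set (tl q) \<subseteq> D" "u 0 \<notin> D" for p q :: "'f list" and u u'
  proof
    assume less: "length p < length q"
    have "u 0 = (p \<frown> u) (length p)" by simp
    also have "\<dots> = q ! length p" using that(1) less by simp
    also have "\<dots> = tl q ! (length p - 1)" using that(2) less by (cases q) (auto simp: nth_Cons')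
    also have "\<dots> \<in> set (tl q)" using that(2) less by (intro nth_mem) (cases p; auto)
    finally show False using that by blast
  qed
  have "length p = length q"
    using *[of p u q u'] *[of q u' p u] assms by fastforce
  then show ?thesis using assms(1) by simp
qed

text \<open>Unique readability identifies the leading image words, injectivity of
  \<open>\<theta>\<close> the leading arcs, and the remaining paths again have equal images.\<close>

lemma inj_subst_word:
  assumes "x \<in> inf_paths E" "y \<in> inf_paths E" "subst_word x = subst_word y"
  shows "x = y"
proof
  fix n
  show "x n = y n" using assms
  proof (induction n arbitrary: x y)
    have step: "x 0 = y 0 \<and> subst_word (suffix (Suc 0) x) = subst_word (suffix (Suc 0) y)"
      if xy: "x \<in> inf_paths E" "y \<in> inf_paths E" "subst_word x = subst_word y" for x y
    proof -
      have arcs: "x 0 \<in> arcs E" "y 0 \<in> arcs E" using inf_paths_arcs xy by blast+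
      have eq: "\<theta> (x 0) \<frown> subst_word (suffix (Suc 0) x) = \<theta> (y 0) \<frown> subst_word (suffix (Suc 0) y)"
        using subst_word_step xy by metis
      then have "\<theta> (x 0) = \<theta> (y 0)"
        using arcs xy
        by (intro image_parse[OF eq] image_nonempty image_tl subst_word_0_notin inf_paths_suffix)
      with eq arcs show ?thesis using inj_image by (auto dest: inj_onD)
    qed
    {
      case 0
      then show ?case using step by blast
    next
      case (Suc n)
      then show ?case
        using step[of x y] Suc.IH[of "suffix (Suc 0) x" "suffix (Suc 0) y"] inf_paths_suffix
        by fastforce
    }
  qed
qed

text \<open>\<open>decode\<close> splits off a single image word and leaves a remainder that again
  starts outside \<open>D\<close>, so it can be iterated by dependent choice.\<close>

lemma surj_subst_word:
  assumes y: "y \<in> inf_paths F" "y 0 \<notin> D"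
  shows "\<exists>x \<in> inf_paths E. subst_word x = y"
proof -
  \<comment> \<open>A state is the arc just decoded together with the path still to be
    decoded.\<close>
  define ok where "ok = (\<lambda>s :: 'e \<times> 'f word. fst s \<in> arcs E \<and> snd s \<in> inf_paths F \<and> snd s 0 \<notin> D)"
  have ex: "\<exists>s. ok s \<and> y = \<theta> (fst s) \<frown> snd s" if y': "y \<in> inf_paths F" "y 0 \<notin> D" for y
  proof -
    obtain e z where "e \<in> arcs E" "z 0 \<notin> D" "y = \<theta> e \<frown> z" using decode[OF y'] by blast
    then show ?thesis
      using y' inf_paths_conc_tail[of "\<theta> e" z F] by (intro exI[of _ "(e, z)"]) (simp add: ok_def)
  qed
  \<comment> \<open>The clause for \<open>n = 0\<close> ties the chosen sequence to
    \<open>y\<close>.\<close>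
  have "\<exists>s. \<forall>n. (ok (s n) \<and> (n = 0 \<longrightarrow> y = \<theta> (fst (s n)) \<frown> snd (s n))) \<and>
      snd (s n) = \<theta> (fst (s (Suc n))) \<frown> snd (s (Suc n))"
    using dependent_nat_choice[of "\<lambda>n s. ok s \<and> (n = 0 \<longrightarrow> y = \<theta> (fst s) \<frown> snd s)"
        "\<lambda>n s s'. snd s = \<theta> (fst s') \<frown> snd s'"] ex y
    by (auto simp: ok_def)
  then obtain s where s: "\<And>n. ok (s n)" "y = \<theta> (fst (s 0)) \<frown> snd (s 0)"
    "\<And>n. snd (s n) = \<theta> (fst (s (Suc n))) \<frown> snd (s (Suc n))" by blast
  define x where "x = (\<lambda>n. fst (s n))"
  have src: "inf_source F (snd (s n)) = tail E (x (Suc n))" for n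
  proof -
    have e: "x (Suc n) \<in> arcs E" using s(1)[of "Suc n"] by (simp add: ok_def x_def)
    show ?thesis
      using s(3)[of n] image_awalk[OF e] image_nonempty[OF e]
      by (cases "\<theta> (x (Suc n))") (auto simp: inf_source_def F.awalk_Cons_iff x_def)
  qed
  \<comment> \<open>\<open>decode\<close> does not say that successive arcs meet. A nonempty walk
    determines its ends, so the remainder must start where the decoded arc ends.\<close>
  have tgt: "inf_source F z = head E e" if e: "e \<in> arcs E" and z: "\<theta> e \<frown> z \<in> inf_paths F" for e z
  proof -
    have "F.awalk (tail F ((\<theta> e \<frown> z) 0)) (\<theta> e) (tail F (z 0))"
      using F.inf_paths_prefix_awalk[OF z, of "length (\<theta> e)"] by simp
    then show ?thesis
      using F.awalk_ends[OF image_awalk[OF e]] image_nonempty[OF e] by (auto simp: inf_source_def)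
  qed
  have tgt_s: "inf_source F (snd (s n)) = head E (x n)" for n
  proof (rule tgt)
    show "x n \<in> arcs E" using s(1)[of n] by (simp add: ok_def x_def)
    show "\<theta> (x n) \<frown> snd (s n) \<in> inf_paths F"
    proof (cases n)
      case 0
      then show ?thesis using s(2) y(1) by (simp add: x_def)
    next
      case (Suc k)
      then show ?thesis using s(3)[of k] s(1)[of k] by (simp add: x_def ok_def)
    qed
  qed
  have x: "x \<in> inf_paths E"
    unfolding inf_paths_def using s(1) tgt_s src by (auto simp: x_def ok_def)
  have pre: "y = subst_list (prefix (Suc n) x) \<frown> snd (s n)" for n
  proof (induction n)
    case 0
    then show ?case using s(2) by (simp add: x_def)
  next
    case (Suc n)
    then show ?case using s(3)[of n] by (simp add: x_def)
  qed
  have "subst_word x n = y n" for n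
  proof -
    have "n < length (subst_list (prefix (Suc n) x))"
      using pos_ge[OF x, of "Suc n"] unfolding pos_def by linarith
    then have "(subst_list (prefix (Suc n) x) \<frown> snd (s n)) n = subst_word x n"
      unfolding subst_word_def by (rule conc_fst)
    then show ?thesis using pre[of n] by metis
  qed
  with x show ?thesis by blast
qed

text \<open>Within an image word only the initial letter is outside \<open>D\<close>, so the
  boundaries of image words are visible in F. The induction strips the leading image word.\<close>

lemma pos_of_cut:
  assumes "x \<in> inf_paths E" "subst_word x N \<notin> D"
  shows "\<exists>n. pos x n = N"
  using assms
proof (induction N arbitrary: x rule: less_induct)
  case (less N)
  have e: "x 0 \<in> arcs E" using inf_paths_arcs less.prems(1) .
  let ?p = "\<theta> (x 0)"
  show ?case
  proof (cases "N = 0")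
    case True
    then show ?thesis by (auto intro: exI[of _ 0])
  next
    case False
    have word: "subst_word x = ?p \<frown> subst_word (suffix (Suc 0) x)"
      by (rule subst_word_step[OF less.prems(1)])
    have "\<not> N < length ?p"
    proof
      assume N: "N < length ?p"
      then have "subst_word x N = ?p ! N" using word by simp
      also have "\<dots> \<in> set (tl ?p)"
        using N False nth_mem[of "N - 1" "tl ?p"] by (cases ?p) (auto simp: nth_Cons')
      finally show False using less.prems(2) image_tl[OF e] by blast
    qed
    then have "subst_word (suffix (Suc 0) x) (N - length ?p) \<notin> D"
      using word less.prems(2) by simp
    moreover have "N - length ?p < N" using False image_nonempty[OF e] by simp
    ultimately obtain n where "pos (suffix (Suc 0) x) n = N - length ?p"
      using less.IH inf_paths_suffix[OF less.prems(1)] by blast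
    then have "pos x (Suc 0 + n) = N"
      using \<open>\<not> N < length ?p\<close> unfolding pos_add by (simp add: pos_def)
    then show ?thesis by blast
  qed
qed

section \<open>The lag cocycle and the map on arrows\<close>

text \<open>The argument \<open>k\<close> is kept because the end paths need not determine it, for
  example when their common tail is periodic. That the description picks out a single value is
  \<open>lag_eq\<close>.\<close>

definition lag :: "'e word \<Rightarrow> int \<Rightarrow> 'e word \<Rightarrow> int" where
  "lag x k y = (THE l. \<exists>m n. k = int m - int n \<and> suffix m x = suffix n y \<and>
     l = int (pos x m) - int (pos y n))"

definition arrow_map :: "'e path_arrow \<Rightarrow> 'f path_arrow" where
  "arrow_map = (\<lambda>(x, k, y). (subst_word x, lag x k y, subst_word y))"

text \<open>Moving both cuts along the common tail adds the same image letters on both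
  sides.\<close>

lemma pos_diff_shift:
  "suffix m x = suffix n y \<Longrightarrow>
     int (pos x (m + p)) - int (pos y (n + p)) = int (pos x m) - int (pos y n)"
  by (simp add: pos_add)

text \<open>Two cuts with the same difference of indices are shifts of one another, so
  \<open>pos_diff_shift\<close> makes the value independent of the cut.\<close>

lemma lag_eq:
  assumes "suffix m x = suffix n y"
  shows "lag x (int m - int n) y = int (pos x m) - int (pos y n)"
  unfolding lag_def
proof (rule the_equality)
  fix l
  assume "\<exists>m' n'. int m - int n = int m' - int n' \<and> suffix m' x = suffix n' y \<and>
    l = int (pos x m') - int (pos y n')"
  then obtain m' n' where *: "int m - int n = int m' - int n'" "suffix m' x = suffix n' y"
    "l = int (pos x m') - int (pos y n')" by blast
  show "l = int (pos x m) - int (pos y n)"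
  proof (cases "m \<le> m'")
    case True
    then have "m' = m + (m' - m)" "n' = n + (m' - m)" using *(1) by linarith+
    then show ?thesis using pos_diff_shift[OF assms, of "m' - m"] *(3) by simp
  next
    case False
    then have "m = m' + (m - m')" "n = n' + (m - m')" using *(1) by linarith+
    then show ?thesis using pos_diff_shift[OF *(2), of "m - m'"] *(3) by simp
  qed
qed (use assms in blast)

lemma lag_add:
  assumes "tail_equiv k x y" "tail_equiv l y z"
  shows "lag x (k + l) z = lag x k y + lag y l z"
proof -
  obtain m n where mn: "k = int m - int n" "suffix m x = suffix n y"
    using assms(1) by (auto simp: tail_equiv_iff_suffix)
  obtain p q where pq: "l = int p - int q" "suffix p y = suffix q z"
    using assms(2) by (auto simp: tail_equiv_iff_suffix)
  \<comment> \<open>Both agreements are moved forward until they cut \<open>y\<close> at the same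
    index \<open>n + p\<close>.\<close>
  have xy: "suffix (m + p) x = suffix (n + p) y" by (rule suffix_eq_shift[OF mn(2)])
  have yz: "suffix (n + p) y = suffix (q + n) z"
    using suffix_eq_shift[OF pq(2), of n] by (simp add: add.commute)
  have kl: "k = int (m + p) - int (n + p)" "l = int (n + p) - int (q + n)"
    "k + l = int (m + p) - int (q + n)"
    using mn(1) pq(1) by linarith+
  show ?thesis
    unfolding kl(3) unfolding kl(1,2) lag_eq[OF xy] lag_eq[OF yz] lag_eq[OF trans[OF xy yz]]
    by simp
qed

lemma lag_uminus:
  assumes "tail_equiv k x y"
  shows "lag y (- k) x = - lag x k y"
proof -
  obtain m n where mn: "k = int m - int n" "suffix m x = suffix n y"
    using assms by (auto simp: tail_equiv_iff_suffix)
  then show ?thesis using lag_eq[OF mn(2)] lag_eq[OF mn(2)[symmetric]] by simp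
qed

lemma tail_equiv_subst_word:
  assumes "x \<in> inf_paths E" "y \<in> inf_paths E" "tail_equiv k x y"
  shows "tail_equiv (lag x k y) (subst_word x) (subst_word y)"
proof -
  obtain m n where mn: "k = int m - int n" "suffix m x = suffix n y"
    using assms(3) by (auto simp: tail_equiv_iff_suffix)
  have "suffix (pos x m) (subst_word x) = suffix (pos y n) (subst_word y)"
    by (simp only: suffix_subst_word assms mn(2))
  then show ?thesis using tail_equivI lag_eq[OF mn(2)] mn(1) by simp
qed

text \<open>Once both witnesses cut \<open>x\<close> at the same index, equal lags give equal values
  of \<open>pos y\<close>, and \<open>pos y\<close> is strictly increasing.\<close>

lemma lag_inject:
  assumes "x \<in> inf_paths E" "y \<in> inf_paths E" "tail_equiv k x y" "tail_equiv l x y"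
    and "lag x k y = lag x l y"
  shows "k = l"
proof -
  obtain m n where mn: "k = int m - int n" "suffix m x = suffix n y"
    using assms(3) by (auto simp: tail_equiv_iff_suffix)
  obtain m' n' where mn': "l = int m' - int n'" "suffix m' x = suffix n' y"
    using assms(4) by (auto simp: tail_equiv_iff_suffix)
  have *: "int m - int n = int m' - int n'"
    if mn: "suffix m x = suffix n y" and le: "m \<le> m'"
      and eq: "int (pos x m) - int (pos y n) = int (pos x m') - int (pos y n')" for m n m' n'
  proof -
    have "int (pos x m') - int (pos y (n + (m' - m))) = int (pos x m) - int (pos y n)"
      using pos_diff_shift[OF mn, of "m' - m"] le by simp
    then have "pos y n' = pos y (n + (m' - m))" using eq by linarith
    then have "n' = n + (m' - m)"
      using strict_mono_eq[OF pos_strict_mono[OF assms(2)]] by blast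
    then show ?thesis using le by linarith
  qed
  have "int (pos x m) - int (pos y n) = int (pos x m') - int (pos y n')"
    using assms(5) lag_eq[OF mn(2)] lag_eq[OF mn'(2)] mn(1) mn'(1) by simp
  then show ?thesis
    using *[OF mn(2), of m' n'] *[OF mn'(2), of m n] mn(1) mn'(1) by (cases "m \<le> m'") auto
qed

lemma tail_equiv_lift:
  assumes x: "x \<in> inf_paths E" and y: "y \<in> inf_paths E"
    and "tail_equiv l (subst_word x) (subst_word y)"
  shows "\<exists>k. tail_equiv k x y \<and> lag x k y = l"
proof -
  obtain M N where MN: "l = int M - int N" "suffix M (subst_word x) = suffix N (subst_word y)"
    using assms(3) by (auto simp: tail_equiv_iff_suffix)
  \<comment> \<open>Move the common tail forward until it starts at the beginning of an image word.\<close>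
  define p where "p = pos x M - M"
  have M: "M + p = pos x M" using pos_ge[OF x, of M] by (simp add: p_def)
  have tails: "suffix (M + p) (subst_word x) = suffix (N + p) (subst_word y)"
    by (rule suffix_eq_shift[OF MN(2)])
  \<comment> \<open>This letter also opens an image word of \<open>x\<close>, hence is outside
    \<open>D\<close>, which forces an image-word boundary in \<open>y\<close> at the same
    place.\<close>
  have "suffix (N + p) (subst_word y) 0 = subst_word (suffix M x) 0"
    using tails by (simp only: M suffix_subst_word[OF x])
  then have "subst_word y (N + p) \<notin> D"
    using subst_word_0_notin[OF inf_paths_suffix[OF x, of M]] by simp
  then obtain n where n: "pos y n = N + p" using pos_of_cut[OF y] by blast
  have "subst_word (suffix M x) = subst_word (suffix n y)"
    using tails by (simp only: M n[symmetric] suffix_subst_word x y)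
  then have eq: "suffix M x = suffix n y"
    by (intro inj_subst_word inf_paths_suffix x y)
  have "lag x (int M - int n) y = l"
    unfolding lag_eq[OF eq] n M[symmetric] MN(1) by simp
  then show ?thesis using tail_equivI[OF eq] by blast
qed

lemma arrow_map_conc:
  assumes "\<alpha> \<frown> t \<in> inf_paths E" "\<beta> \<frown> t \<in> inf_paths E"
  shows "arrow_map (\<alpha> \<frown> t, int (length \<alpha>) - int (length \<beta>), \<beta> \<frown> t) =
    (subst_list \<alpha> \<frown> subst_word t, int (length (subst_list \<alpha>)) - int (length (subst_list \<beta>)),
     subst_list \<beta> \<frown> subst_word t)"
proof -
  have "suffix (length \<alpha>) (\<alpha> \<frown> t) = suffix (length \<beta>) (\<beta> \<frown> t)" by simp
  from lag_eq[OF this] show ?thesis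
    by (simp add: arrow_map_def subst_word_conc assms pos_def)
qed

lemma arrow_map_in:
  "a \<in> path_arrows_over E S \<Longrightarrow> arrow_map a \<in> path_arrows_over F S"
  by (cases a) (auto simp: arrow_map_def path_arrows_over_iff subst_word_inf_paths
      inf_source_subst_word intro: tail_equiv_subst_word)

section \<open>Bijectivity and bicontinuity\<close>

text \<open>The range of \<open>subst_word\<close> consists of the paths of F whose first arc is
  outside \<open>D\<close>; the condition on \<open>S\<close> ensures this for every path of F
  starting in \<open>S\<close>.\<close>

lemma bij_arrow_map:
  assumes S: "\<And>d. d \<in> D \<Longrightarrow> tail F d \<notin> S"
  shows "bij_betw arrow_map (path_arrows_over E S) (path_arrows_over F S)"
  unfolding bij_betw_def
proof
  show "inj_on arrow_map (path_arrows_over E S)"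
  proof (rule inj_onI)
    fix a b
    assume *: "a \<in> path_arrows_over E S" "b \<in> path_arrows_over E S" "arrow_map a = arrow_map b"
    obtain x k y where a: "a = (x, k, y)" by (cases a) auto
    obtain x' l y' where b: "b = (x', l, y')" by (cases b) auto
    have "x = x'" "y = y'"
      using * by (auto simp: a b arrow_map_def path_arrows_over_iff intro: inj_subst_word)
    then show "a = b"
      using * by (auto simp: a b arrow_map_def path_arrows_over_iff intro: lag_inject)
  qed
  show "arrow_map ` path_arrows_over E S = path_arrows_over F S"
  proof (intro equalityI subsetI)
    fix b assume b: "b \<in> path_arrows_over F S"
    obtain x' l y' where b': "b = (x', l, y')" by (cases b) auto
    have "x' 0 \<notin> D" "y' 0 \<notin> D" using b S by (auto simp: b' path_arrows_over_iff inf_source_def)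
    then obtain x y where xy: "x \<in> inf_paths E" "subst_word x = x'" "y \<in> inf_paths E" "subst_word y = y'"
      using b surj_subst_word[of x'] surj_subst_word[of y'] by (auto simp: b' path_arrows_over_iff)
    then obtain k where k: "tail_equiv k x y" "lag x k y = l"
      using b tail_equiv_lift[of x y l] by (auto simp: b' path_arrows_over_iff)
    then have "(x, k, y) \<in> path_arrows_over E S"
      using b xy inf_source_subst_word by (auto simp: b' path_arrows_over_iff)
    moreover have "arrow_map (x, k, y) = b" using xy k by (simp add: arrow_map_def b')
    ultimately show "b \<in> arrow_map ` path_arrows_over E S" by force
  qed (use arrow_map_in in blast)
qed

lemma arrow_map_cylinder_preimage:
  assumes a: "a \<in> path_arrows_over E S" and Z: "Z \<in> path_cylinders F" "arrow_map a \<in> Z"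
  shows "\<exists>U \<in> path_cylinders E. a \<in> U \<and> arrow_map ` (U \<inter> path_arrows_over E S) \<subseteq> Z"
proof -
  obtain x k y where axy: "a = (x, k, y)" by (cases a) auto
  have x: "x \<in> inf_paths E" and y: "y \<in> inf_paths E" and k: "tail_equiv k x y"
    using a by (auto simp: axy path_arrows_over_iff)
  obtain \<alpha>' \<beta>' w' where Z': "Z = path_cylinder F \<alpha>' \<beta>' w'"
    using Z(1) by (auto simp: path_cylinders_def)
  obtain z' where z': "subst_word x = \<alpha>' \<frown> z'" "subst_word y = \<beta>' \<frown> z'"
    "lag x k y = int (length \<alpha>') - int (length \<beta>')" "inf_source F z' = w'"
    using Z(2) by (auto simp: Z' axy arrow_map_def path_cylinder_def)
  obtain m0 n0 where mn0: "k = int m0 - int n0" "suffix m0 x = suffix n0 y"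
    using k by (auto simp: tail_equiv_iff_suffix)
  \<comment> \<open>The successor makes the image of the first \<open>m\<close> arcs overshoot
    \<open>\<alpha>'\<close> by at least one letter. That letter is \<open>z' 0\<close>, which fixes
    the source \<open>w'\<close> of the continuation.\<close>
  define m where "m = m0 + Suc (length \<alpha>')"
  define n where "n = n0 + Suc (length \<alpha>')"
  have kmn: "k = int m - int n" using mn0(1) by (simp add: m_def n_def)
  have mn: "suffix m x = suffix n y" unfolding m_def n_def by (rule suffix_eq_shift[OF mn0(2)])
  define q where "q = pos x m - length \<alpha>'"
  have "m \<le> pos x m" by (rule pos_ge[OF x])
  then have q: "q > 0" "pos x m = length \<alpha>' + q" by (auto simp: q_def m_def)
  \<comment> \<open>Equality of lags makes the overshoot beyond \<open>\<beta>'\<close> the same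
    \<open>q\<close>, so both sides continue with the same segment of \<open>z'\<close>.\<close>
  have "int (pos x m) - int (pos y n) = int (length \<alpha>') - int (length \<beta>')"
    using lag_eq[OF mn] z'(3) kmn by simp
  then have qy: "pos y n = length \<beta>' + q" using q(2) by linarith
  let ?\<gamma> = "prefix q z'"
  have sx: "subst_list (prefix m x) = \<alpha>' @ ?\<gamma>"
    using prefix_subst_word[OF x, of m] by (simp add: q(2) z'(1))
  have sy: "subst_list (prefix n y) = \<beta>' @ ?\<gamma>"
    using prefix_subst_word[OF y, of n] by (simp add: qy z'(2))
  let ?U = "path_cylinder E (prefix m x) (prefix n y) (tail E (x m))"
  show ?thesis
  proof (intro bexI conjI)
    show "?U \<in> path_cylinders E" by (rule E.prefix_cylinder[OF x y mn])
    show "a \<in> ?U" unfolding axy kmn by (rule E.prefix_cylinder[OF x y mn])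
    show "arrow_map ` (?U \<inter> path_arrows_over E S) \<subseteq> Z"
    proof (rule image_subsetI)
      fix b
      assume b: "b \<in> ?U \<inter> path_arrows_over E S"
      obtain x1 k1 y1 where b': "b = (x1, k1, y1)" by (cases b) auto
      from b have U: "(x1, k1, y1) \<in> ?U" and A: "(x1, k1, y1) \<in> path_arrows_over E S"
        by (auto simp: b')
      from U obtain t where t: "t \<in> inf_paths E" "x1 = prefix m x \<frown> t" "y1 = prefix n y \<frown> t"
        "k1 = int (length (prefix m x)) - int (length (prefix n y))"
        by (auto simp: path_cylinder_def)
      have x1: "x1 \<in> inf_paths E" and y1: "y1 \<in> inf_paths E"
        using A by (auto simp: path_arrows_over_iff)
      have img: "arrow_map (x1, k1, y1) = (\<alpha>' \<frown> (?\<gamma> \<frown> subst_word t),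
          int (length \<alpha>') - int (length \<beta>'), \<beta>' \<frown> (?\<gamma> \<frown> subst_word t))"
        using arrow_map_conc[of "prefix m x" t "prefix n y"] x1 y1
        unfolding t sx sy by simp
      have "\<alpha>' \<frown> (?\<gamma> \<frown> subst_word t) \<in> inf_paths F"
        using subst_word_inf_paths[OF x1] img by (simp add: arrow_map_def)
      then have "?\<gamma> \<frown> subst_word t \<in> inf_paths F" by (rule inf_paths_conc_tail)
      moreover have "inf_source F (?\<gamma> \<frown> subst_word t) = w'"
        using q(1) z'(4) by (simp add: inf_source_def)
      ultimately show "arrow_map b \<in> Z"
        unfolding b' img Z' path_cylinder_def by blast
    qed
  qed
qed

text \<open>Openness of the map. The cylinder of \<open>subst_list \<alpha>\<close> and
  \<open>subst_list \<beta>\<close> may be too large: if an arc of \<open>D\<close> starts at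
  \<open>w\<close>, it contains paths continued by that arc, whereas \<open>subst_word s\<close>
  never starts in \<open>D\<close>.\<close>

lemma arrow_map_cylinder_image:
  assumes a: "a \<in> path_arrows_over E S" and Z: "Z \<in> path_cylinders E" "a \<in> Z"
  shows "\<exists>U \<in> path_cylinders F. arrow_map a \<in> U \<and>
    U \<inter> path_arrows_over F S \<subseteq> arrow_map ` (Z \<inter> path_arrows_over E S)"
proof -
  obtain \<alpha> \<beta> w u u' where Z': "Z = path_cylinder E \<alpha> \<beta> w"
    and walks: "E.awalk u \<alpha> w" "E.awalk u' \<beta> w"
    using Z(1) by (auto simp: path_cylinders_def)
  obtain z where z: "z \<in> inf_paths E" "inf_source E z = w"
    and a': "a = (\<alpha> \<frown> z, int (length \<alpha>) - int (length \<beta>), \<beta> \<frown> z)"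
    using Z(2) by (auto simp: Z' path_cylinder_def)
  let ?c = "subst_word z 0"
  have sz: "subst_word z \<in> inf_paths F" by (rule subst_word_inf_paths[OF z(1)])
  have c: "?c \<in> arcs F" "tail F ?c = w"
    using inf_paths_arcs[OF sz] inf_source_subst_word[OF z(1)] z(2) by (auto simp: inf_source_def)
  then have w: "w \<in> verts F" by auto
  have cw: "F.awalk w [?c] (head F ?c)" using F.arc_implies_awalk[of ?c] c by simp
  \<comment> \<open>The extra letter \<open>?c\<close> begins an image word, so that whatever follows it can be decoded.\<close>
  let ?U = "path_cylinder F (subst_list \<alpha> @ [?c]) (subst_list \<beta> @ [?c]) (head F ?c)"
  show ?thesis
  proof (intro bexI conjI)
    show "?U \<in> path_cylinders F"
      unfolding path_cylinders_def
      using F.awalk_appendI[OF awalk_subst_list[OF walks(1) w] cw]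
        F.awalk_appendI[OF awalk_subst_list[OF walks(2) w] cw] by blast
    have src: "inf_source F (suffix (Suc 0) (subst_word z)) = head F ?c"
      using sz by (simp add: inf_source_def inf_paths_def)
    have az: "\<alpha> \<frown> z \<in> inf_paths E" "\<beta> \<frown> z \<in> inf_paths E"
      using a by (auto simp: a' path_arrows_over_iff)
    show "arrow_map a \<in> ?U"
      unfolding a' arrow_map_conc[OF az] path_cylinder_def
      using inf_paths_suffix[OF sz, of "Suc 0"] src
      by (auto intro!: exI[of _ "suffix (Suc 0) (subst_word z)"])
    show "?U \<inter> path_arrows_over F S \<subseteq> arrow_map ` (Z \<inter> path_arrows_over E S)"
    proof
      fix b assume b: "b \<in> ?U \<inter> path_arrows_over F S"
      then obtain t where bt: "b = (subst_list \<alpha> \<frown> (?c ## t),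
          int (length (subst_list \<alpha>)) - int (length (subst_list \<beta>)), subst_list \<beta> \<frown> (?c ## t))"
        by (auto simp: path_cylinder_def)
      have "?c ## t \<in> inf_paths F"
        using b inf_paths_conc_tail[of "subst_list \<alpha>" "?c ## t" F]
        by (auto simp: bt path_arrows_over_iff)
      then obtain s where s: "s \<in> inf_paths E" "subst_word s = ?c ## t"
        using surj_subst_word[of "?c ## t"] subst_word_0_notin[OF z(1)] by auto
      have sw: "inf_source E s = w"
        using inf_source_subst_word[OF s(1)] c by (simp add: s(2) inf_source_def)
      have conc: "\<alpha> \<frown> s \<in> inf_paths E" "\<beta> \<frown> s \<in> inf_paths E"
        using E.inf_paths_conc walks s(1) sw by blast+
      let ?b = "(\<alpha> \<frown> s, int (length \<alpha>) - int (length \<beta>), \<beta> \<frown> s)"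
      have img: "arrow_map ?b = b" unfolding arrow_map_conc[OF conc] s(2) bt ..
      have "?b \<in> Z" unfolding Z' path_cylinder_def using s(1) sw by blast
      moreover have "?b \<in> path_arrows_over E S"
        using b conc inf_source_subst_word[OF conc(1)] inf_source_subst_word[OF conc(2)]
          tail_equivI[of "length \<alpha>" "\<alpha> \<frown> s" "length \<beta>" "\<beta> \<frown> s"]
        unfolding bt subst_word_conc[OF conc(1)] subst_word_conc[OF conc(2)] s(2)
        by (auto simp: path_arrows_over_iff)
      ultimately show "b \<in> arrow_map ` (Z \<inter> path_arrows_over E S)" using img by blast
    qed
  qed
qed

theorem restricted_path_groupoid_iso:
  assumes S: "\<And>d. d \<in> D \<Longrightarrow> tail F d \<notin> S"
  shows "top_groupoid_iso (restricted_path_groupoid E S) (restricted_path_groupoid F S) arrow_map"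
proof -
  let ?A = "path_arrows_over E S" and ?B = "path_arrows_over F S"
  let ?X = "subtopology (path_topology E) ?A" and ?Y = "subtopology (path_topology F) ?B"
  let ?inv = "inv_into ?A arrow_map"
  have bij: "bij_betw arrow_map ?A ?B" by (rule bij_arrow_map[OF S])
  have inv: "?inv b \<in> ?A" "arrow_map (?inv b) = b" if "b \<in> ?B" for b
    using that bij by (auto simp: bij_betw_def inv_into_into f_inv_into_f)
  have inv': "?inv (arrow_map a) = a" if "a \<in> ?A" for a
    using that bij by (auto simp: bij_betw_def)
  have "continuous_map ?X ?Y arrow_map"
    by (rule continuous_map_path_subtopology[OF E.wf_digraph_axioms F.wf_digraph_axioms])
      (simp_all add: arrow_map_in arrow_map_cylinder_preimage)
  moreover have "continuous_map ?Y ?X ?inv"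
  proof (rule continuous_map_path_subtopology[OF F.wf_digraph_axioms E.wf_digraph_axioms])
    fix b Z
    assume b: "b \<in> ?B" and Z: "Z \<in> path_cylinders E" "?inv b \<in> Z"
    obtain U where U: "U \<in> path_cylinders F" "b \<in> U" "U \<inter> ?B \<subseteq> arrow_map ` (Z \<inter> ?A)"
      using arrow_map_cylinder_image[OF inv(1)[OF b] Z] inv(2)[OF b] by auto
    have "?inv ` (U \<inter> ?B) \<subseteq> Z" using U(3) inv' by fastforce
    with U show "\<exists>U \<in> path_cylinders F. b \<in> U \<and> ?inv ` (U \<inter> ?B) \<subseteq> Z" by blast
  qed (rule inv)
  ultimately have "homeomorphic_maps ?X ?Y arrow_map ?inv"
    unfolding homeomorphic_maps_def E.topspace_path_subtopology F.topspace_path_subtopology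
    using inv inv' by blast
  then have "homeomorphic_map ?X ?Y arrow_map"
    using homeomorphic_map_maps by blast
  \<comment> \<open>Composability compares the middle paths, so reflecting it needs injectivity of
    \<open>subst_word\<close>.\<close>
  moreover have "x = y \<longleftrightarrow> subst_word x = subst_word y"
    if "x \<in> inf_paths E" "y \<in> inf_paths E" for x y
    using inj_subst_word that by blast
  ultimately show ?thesis
    unfolding top_groupoid_iso_def restricted_path_groupoid_simps
    using bij arrow_map_in[of _ S]
    by (auto simp: arrow_map_def path_arrows_over_iff lag_add lag_uminus)
qed

end

lemma (in nomulti_digraph) vertex_matrix_nomulti:
  "vertex_matrix G u w = (if \<exists>e \<in> arcs G. tail G e = u \<and> head G e = w then 1 else 0)"
proof (cases "\<exists>e \<in> arcs G. tail G e = u \<and> head G e = w")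
  case True
  then obtain e where e: "e \<in> arcs G" "tail G e = u" "head G e = w" by blast
  then have "{e \<in> arcs G. tail G e = u \<and> head G e = w} = {e}"
    using no_multi_arcs by (auto simp: arc_to_ends_def)
  with True show ?thesis by (simp add: vertex_matrix_def)
next
  case False
  then have "{e \<in> arcs G. tail G e = u \<and> head G e = w} = {}" by blast
  with False show ?thesis by (simp only: vertex_matrix_def) simp
qed

theorem proposition5p5:
  fixes E :: "('a, 'e) pre_digraph" and F :: "('a, 'f) pre_digraph" and v :: 'a
  assumes "path_graph E" and "row_finite E"
    and "path_graph F" and "row_finite F"
    and "reverse_primitive_transfer E F v"
  shows "top_groupoid_isomorphic
           (restricted_path_groupoid E {v}) (restricted_path_groupoid F {v})"

\<comment> \<open>The substitution of a reverse primitive transfer\<close>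
proof -
  interpret E: path_graph E by fact
  interpret F: path_graph F by fact
  define adjE where "adjE u w \<longleftrightarrow> (\<exists>e \<in> arcs E. tail E e = u \<and> head E e = w)" for u w
  define adjF where "adjF u w \<longleftrightarrow> (\<exists>f \<in> arcs F. tail F f = u \<and> head F f = w)" for u w
  have matE: "vertex_matrix E u w = (if adjE u w then 1 else 0)" for u w
    by (simp add: E.vertex_matrix_nomulti adjE_def)
  have matF: "vertex_matrix F u w = (if adjF u w then 1 else 0)" for u w
    by (simp add: F.vertex_matrix_nomulti adjF_def)
  have V: "verts F = verts E"
    and transfer: "primitive_transfer (verts E)
       (matrix_transpose (vertex_matrix E)) (matrix_transpose (vertex_matrix F)) v"
    using assms(5) by (auto simp: reverse_primitive_transfer_def)
  from transfer obtain K M where fin: "finite K" "finite M" and KM: "K \<inter> M = {}" "v \<notin> M" "M \<subseteq> verts E"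
    and col: "\<forall>j \<in> verts E. vertex_matrix E j v =
       (\<Sum>k \<in> K. if j = k then 1 else 0) + (\<Sum>m \<in> M. vertex_matrix E j m)"
    and same: "\<forall>i \<in> verts E. i \<noteq> v \<longrightarrow> (\<forall>j \<in> verts E. vertex_matrix F j i = vertex_matrix E j i)"
    and colF: "\<forall>j \<in> verts E. vertex_matrix F j v = (if j \<in> K \<union> M then 1 else 0)"
    and v: "v \<in> verts E"
    unfolding primitive_transfer_def matrix_transpose_def by blast
  have adjF_v: "adjF j v \<longleftrightarrow> j \<in> K \<union> M" if "j \<in> verts E" for j
    using colF that by (auto simp: matF split: if_splits)
  have adjF_same: "adjF j i \<longleftrightarrow> adjE j i" if "i \<noteq> v" "i \<in> verts E" "j \<in> verts E" for i j
    using same that by (auto simp: matE matF split: if_splits)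
  have adjE_K: "adjE j v" if "j \<in> K" "j \<in> verts E" for j
  proof -
    have "(\<Sum>k \<in> K. if j = k then 1 else 0) = (1 :: nat)" using fin that by simp
    then show ?thesis using col that(2) by (auto simp: matE split: if_splits)
  qed
  \<comment> \<open>The arc \<open>j -> m\<close> already contributes 1 to an entry that is at most
    1, which leaves 0 for the sum over \<open>K\<close>.\<close>
  have adjE_M: "adjE j v \<and> j \<notin> K" if "adjE j m" "m \<in> M" "j \<in> verts E" for j m
  proof -
    have "1 \<le> (\<Sum>m \<in> M. vertex_matrix E j m)"
      using member_le_sum[of m M "\<lambda>m. vertex_matrix E j m"] that fin by (simp add: matE)
    moreover have "vertex_matrix E j v \<le> 1" by (simp add: matE)
    moreover have "vertex_matrix E j v =
        (\<Sum>k \<in> K. if j = k then 1 else 0) + (\<Sum>m \<in> M. vertex_matrix E j m)"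
      using col that(3) by blast
    ultimately have "vertex_matrix E j v = 1" "(\<Sum>k \<in> K. if j = k then 1 else 0) = (0 :: nat)"
      by linarith+
    then show ?thesis using fin by (auto simp: matE split: if_splits)
  qed
  have adjE_v: "j \<in> K \<or> (\<exists>m \<in> M. adjE j m)" if "adjE j v" "j \<in> verts E" for j
  proof (rule ccontr)
    assume "\<not> ?thesis"
    then have "(\<Sum>k \<in> K. if j = k then 1 else 0) + (\<Sum>m \<in> M. vertex_matrix E j m) = 0"
      using fin by (auto simp: matE)
    then show False using col that by (auto simp: matE)
  qed
  \<comment> \<open>Two such vertices would push the entry at \<open>v\<close> up to 2.\<close>
  have adjE_M_unique: "m = m'" if "adjE j m" "adjE j m'" "m \<in> M" "m' \<in> M" "j \<in> verts E" for j m m'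
  proof (rule ccontr)
    assume "m \<noteq> m'"
    then have "2 = (\<Sum>m \<in> {m, m'}. vertex_matrix E j m)" using that by (simp add: matE)
    also have "\<dots> \<le> (\<Sum>m \<in> M. vertex_matrix E j m)" by (rule sum_mono2) (use fin that in auto)
    also have "\<dots> \<le> vertex_matrix E j v" using col that(5) by simp
    finally show False by (simp add: matE split: if_splits)
  qed

  define arc where "arc u w = (SOME f. f \<in> arcs F \<and> tail F f = u \<and> head F f = w)" for u w
  have arc: "arc u w \<in> arcs F \<and> tail F (arc u w) = u \<and> head F (arc u w) = w" if "adjF u w" for u w
    unfolding arc_def by (rule someI_ex) (use that in \<open>auto simp: adjF_def\<close>)
  have arc_eq: "f = arc u w" if "f \<in> arcs F" "tail F f = u" "head F f = w" for f u w
  proof -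
    have "adjF u w" using that by (auto simp: adjF_def)
    from arc[OF this] show ?thesis
      using that F.no_multi_arcs[of f "arc u w"] by (auto simp: arc_to_ends_def)
  qed
  \<comment> \<open>The middle vertex of the detour; the choice is unique by
    \<open>adjE_M_unique\<close>.\<close>
  define mid where "mid j = (SOME m. m \<in> M \<and> adjE j m)" for j
  have mid: "mid j \<in> M \<and> adjE j (mid j)" if "adjE j v" "j \<notin> K" "j \<in> verts E" for j
    unfolding mid_def by (rule someI_ex) (use adjE_v[OF that(1,3)] that in blast)
  \<comment> \<open>The second arcs of detours.\<close>
  define D where "D = {f \<in> arcs F. tail F f \<in> M \<and> head F f = v}"
  define \<theta> where "\<theta> e = (let j = tail E e; w = head E e in
      if w = v \<and> j \<notin> K then [arc j (mid j), arc (mid j) v] else [arc j w])" for e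
  have \<theta>: "(\<theta> e = [arc (tail E e) (head E e)] \<and> adjF (tail E e) (head E e) \<and>
        (head E e = v \<longrightarrow> tail E e \<in> K)) \<or>
      (\<exists>m \<in> M. \<theta> e = [arc (tail E e) m, arc m v] \<and> adjF (tail E e) m \<and> adjF m v \<and> head E e = v)"
    if e: "e \<in> arcs E" for e
  proof -
    let ?j = "tail E e" and ?w = "head E e"
    have verts: "?j \<in> verts E" "?w \<in> verts E" and adj: "adjE ?j ?w"
      using e by (auto simp: adjE_def)
    show ?thesis
    proof (cases "?w = v \<and> ?j \<notin> K")
      case True
      then have m: "mid ?j \<in> M" "adjE ?j (mid ?j)" using mid adj verts by auto
      then have mv: "mid ?j \<noteq> v" "mid ?j \<in> verts E" using KM by auto
      have "adjF ?j (mid ?j)" "adjF (mid ?j) v"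
        using m mv verts adjF_same adjF_v by auto
      then show ?thesis using True m by (auto simp: \<theta>_def Let_def)
    next
      case False
      have "adjF ?j ?w"
        using False adj verts adjF_same adjF_v by (cases "?w = v") auto
      with False show ?thesis by (auto simp: \<theta>_def Let_def)
    qed
  qed
  interpret arc_substitution E F \<theta> D
  proof
    fix e assume e: "e \<in> arcs E"
    have verts: "tail E e \<in> verts F" "head E e \<in> verts F" using e V by auto
    show "F.awalk (tail E e) (\<theta> e) (head E e)"
      using \<theta>[OF e] verts arc by (auto simp: F.awalk_Cons_iff F.awalk_Nil_iff)
    show "\<theta> e \<noteq> []" using \<theta>[OF e] by auto
    \<comment> \<open>An initial letter that ends at \<open>v\<close> has its tail in
      \<open>K\<close>, which is disjoint from \<open>M\<close>; every other initial letter misses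
      \<open>D\<close> because of its head.\<close>
    have "\<exists>w. hd (\<theta> e) = arc (tail E e) w \<and> adjF (tail E e) w \<and> (w = v \<longrightarrow> tail E e \<in> K)"
      using \<theta>[OF e]
    proof
      assume "\<exists>m \<in> M. \<theta> e = [arc (tail E e) m, arc m v] \<and> adjF (tail E e) m \<and> adjF m v \<and> head E e = v"
      then obtain m where "m \<in> M" "\<theta> e = [arc (tail E e) m, arc m v]" "adjF (tail E e) m" by blast
      then show ?thesis using KM by (intro exI[of _ m]) auto
    qed auto
    then show "hd (\<theta> e) \<notin> D" using arc KM by (auto simp: D_def)
    show "set (tl (\<theta> e)) \<subseteq> D" using \<theta>[OF e] arc by (auto simp: D_def)
  next
    show "inj_on \<theta> (arcs E)"
    proof (rule inj_onI)
      fix e e' assume *: "e \<in> arcs E" "e' \<in> arcs E" "\<theta> e = \<theta> e'"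
      \<comment> \<open>The first letter determines the tail. The length of the image word tells the
        cases apart: the head is that of the single letter, or \<open>v\<close> for a
        detour.\<close>
      have "tail E e = tail E e' \<and> head E e = head E e'"
        using \<theta>[OF *(1)] \<theta>[OF *(2)] *(3) arc by (smt (verit) list.inject list.distinct(1))
      then show "e = e'" using * E.no_multi_arcs by (auto simp: arc_to_ends_def)
    qed
  next
    fix y assume y: "y \<in> inf_paths F" "y 0 \<notin> D"
    let ?j = "tail F (y 0)" and ?w = "head F (y 0)"
    have y0: "y 0 \<in> arcs F" and y1: "y 1 \<in> arcs F" "tail F (y 1) = ?w"
      and y2: "y 2 \<in> arcs F" "tail F (y 2) = head F (y 1)"
      using y(1) by (auto simp: inf_paths_def numeral_2_eq_2)
    have verts: "?j \<in> verts E" "?w \<in> verts E"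
      using F.tail_in_verts[OF y0] F.head_in_verts[OF y0] by (simp_all only: V)
    have adj: "adjF ?j ?w" using y0 by (auto simp: adjF_def)
    show "\<exists>e \<in> arcs E. \<exists>z. z 0 \<notin> D \<and> y = \<theta> e \<frown> z"
    proof (cases "y 1 \<in> D")
      \<comment> \<open>Here \<open>y 0\<close> enters \<open>M\<close>, hence does not end at
        \<open>v\<close> and is an arc of E too. This forces an arc from \<open>?j\<close> to
        \<open>v\<close> with \<open>?j\<close> outside \<open>K\<close>, whose detour runs through
        \<open>?w\<close>.\<close>
      case True
      then have wM: "?w \<in> M" "head F (y 1) = v" using y1 by (auto simp: D_def)
      then have wv: "?w \<noteq> v" using KM by auto
      have jw: "adjE ?j ?w" using adjF_same[OF wv] adj verts by simp
      then have jv: "adjE ?j v" "?j \<notin> K" using adjE_M[OF jw wM(1)] verts by auto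
      then obtain e where e: "e \<in> arcs E" "tail E e = ?j" "head E e = v" by (auto simp: adjE_def)
      have "mid ?j = ?w"
        using mid[OF jv verts(1)] adjE_M_unique[OF _ jw _ wM(1) verts(1)] by blast
      then have "\<theta> e = [y 0, y 1]"
        using e jv arc_eq[OF y0] arc_eq[OF y1 wM(2)] by (simp add: \<theta>_def)
      then have "y = \<theta> e \<frown> suffix 2 y"
        using prefix_suffix[of y 2] by (simp add: numeral_2_eq_2 del: prefix_suffix[symmetric])
      \<comment> \<open>After a detour the path is at \<open>v\<close>, which is not in
        \<open>M\<close>.\<close>
      moreover have "suffix 2 y 0 \<notin> D" using y2 wM(2) KM by (simp add: D_def)
      ultimately show ?thesis using e by blast
    next
      case False
      \<comment> \<open>An arc of F into \<open>v\<close> comes from \<open>K\<close> or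
        \<open>M\<close>; since \<open>y 0\<close> is outside \<open>D\<close>, only
        \<open>K\<close> is left.\<close>
      have kw: "?w = v \<Longrightarrow> ?j \<in> K"
        using adj adjF_v[OF verts(1)] y(2) y0 by (auto simp: D_def)
      have "adjE ?j ?w"
        using adj adjF_same[of ?w ?j] adjE_K[of ?j] kw verts by (cases "?w = v") auto
      then obtain e where e: "e \<in> arcs E" "tail E e = ?j" "head E e = ?w" by (auto simp: adjE_def)
      then have "\<theta> e = [arc ?j ?w]" using kw by (auto simp: \<theta>_def Let_def)
      also have "arc ?j ?w = y 0" using arc_eq[OF y0 refl refl] ..
      finally have "y = \<theta> e \<frown> suffix 1 y" by simp
      moreover have "suffix 1 y 0 \<notin> D" using False by simp
      ultimately show ?thesis using e by blast
    qed
  qed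
  have "tail F d \<notin> {v}" if "d \<in> D" for d using that KM by (auto simp: D_def)
  then show ?thesis
    unfolding top_groupoid_isomorphic_def using restricted_path_groupoid_iso by blast
qed

end
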